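(* For integers $m\ge 1$ and $n\ge 2m+3$, $R_{\pi}(K_{1,m},P_n)=n$.
   Context: All graphs are finite and simple. For graphs $F,G,H$, write $F\rightarrow(G,H)$ if every red-blue coloring of the edges of $F$ contains a red copy of $G$ or a blue copy of $H$. The Ramsey number $R(G,H)$ is the smallest $r$ with $K_r\rightarrow(G,H)$. $P_k$ is the path on $k$ vertices, and $K_r\setminus P_k$ denotes $K_r$ with the edges of a path on $k$ vertices ($k\le r$) deleted. The path-critical Ramsey number is $R_{\pi}(G,H)=\max\{k: K_r\setminus P_k\rightarrow(G,H)\}$ where $r=R(G,H)$. $K_{1,m}$ is the star with $m$ leaves. *)

theory Defs
  imports "HOL-Library.Ramsey"
begin

text \<open>A graph is a pair of a vertex set and an edge set; an edge is a two-element set of vertices.\<close>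

type_synonym 'a ugraph = "'a set \<times> 'a set set"

abbreviation vertices :: "'a ugraph \<Rightarrow> 'a set" where
  "vertices G \<equiv> fst G"

abbreviation edges :: "'a ugraph \<Rightarrow> 'a set set" where
  "edges G \<equiv> snd G"

definition simple_graph :: "'a ugraph \<Rightarrow> bool" where
  "simple_graph G \<longleftrightarrow> finite (vertices G) \<and> edges G \<subseteq> [vertices G]\<^bsup>2\<^esup>"

text \<open>Copies are subgraphs, not necessarily induced.\<close>

definition contains_copy :: "'a ugraph \<Rightarrow> 'b ugraph \<Rightarrow> bool" where
  "contains_copy F G \<longleftrightarrow>
    (\<exists>f. inj_on f (vertices G) \<and> f ` vertices G \<subseteq> vertices F \<and> (\<forall>e\<in>edges G. f ` e \<in> edges F))"

definition arrows :: "'a ugraph \<Rightarrow> 'b ugraph \<Rightarrow> 'c ugraph \<Rightarrow> bool" where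
  "arrows F G H \<longleftrightarrow>
    (\<forall>R B. R \<union> B = edges F \<and> R \<inter> B = {} \<longrightarrow>
      contains_copy (vertices F, R) G \<or> contains_copy (vertices F, B) H)"

definition complete_graph :: "nat \<Rightarrow> nat ugraph" where
  "complete_graph r = ({..<r}, [{..<r}]\<^bsup>2\<^esup>)"

definition path_graph :: "nat \<Rightarrow> nat ugraph" where
  "path_graph k = ({..<k}, {{i, Suc i} |i. Suc i < k})"

definition star_graph :: "nat \<Rightarrow> nat ugraph" where
  "star_graph m = ({..m}, {{0, i} |i. 1 \<le> i \<and> i \<le> m})"

text \<open>By symmetry of the complete graph it does not matter which path on \<^term>\<open>k\<close> vertices is
  deleted; for \<^prop>\<open>k \<le> r\<close> the path \<open>0, 1, \<dots>, k - 1\<close> lies in the complete graph.\<close>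

definition complete_minus_path :: "nat \<Rightarrow> nat \<Rightarrow> nat ugraph" where
  "complete_minus_path r k =
    (vertices (complete_graph r), edges (complete_graph r) - edges (path_graph k))"

text \<open>For finite simple graphs the minimum exists by Ramsey's theorem.\<close>

definition ramsey_number :: "'a ugraph \<Rightarrow> 'b ugraph \<Rightarrow> nat" where
  "ramsey_number G H = (LEAST r. arrows (complete_graph r) G H)"

text \<open>The path on one vertex has no edges, so for a positive Ramsey number the set below contains
  \<^term>\<open>1::nat\<close>, and the maximum exists.\<close>

definition path_critical_ramsey :: "'a ugraph \<Rightarrow> 'b ugraph \<Rightarrow> nat" where
  "path_critical_ramsey G H =
    (let r = ramsey_number G H
     in Max {k. 1 \<le> k \<and> k \<le> r \<and> arrows (complete_minus_path r k) G H})"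

lemma simple_graph_complete_graph: "simple_graph (complete_graph r)"
  by (simp add: simple_graph_def complete_graph_def)

lemma simple_graph_path_graph: "simple_graph (path_graph k)"
  by (auto simp: simple_graph_def path_graph_def nsets_def card_insert_if)

lemma simple_graph_star_graph: "simple_graph (star_graph m)"
  by (auto simp: simple_graph_def star_graph_def nsets_def card_insert_if)

lemma simple_graph_complete_minus_path: "simple_graph (complete_minus_path r k)"
  by (auto simp: simple_graph_def complete_minus_path_def complete_graph_def)

end

theory Submission
  imports Defs
begin

text \<open>If a colouring of \<open>K\<^sub>n\<close> minus a Hamiltonian path has no red \<open>K\<^bsub>1,m\<^esub>\<close>, every vertex has at
  least \<open>(n - 3) - (m - 1) \<ge> (n - 1) / 2\<close> blue neighbours, and Dirac's argument gives a blue
  Hamiltonian path: the ends of a longest path have all their neighbours on it, so its vertices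
  span a cycle by pigeonhole, and a vertex outside the cycle adjacent to it would yield a longer
  path. Conversely, an all-blue complete graph on fewer than \<open>n\<close> vertices has no room for \<open>P\<^sub>n\<close>,
  so the Ramsey number is \<open>n\<close>.\<close>

section \<open>Neighbourhoods, and paths as lists of vertices\<close>

definition neighbours :: "'a ugraph \<Rightarrow> 'a \<Rightarrow> 'a set" where
  "neighbours G v = {u. {v, u} \<in> edges G}"

text \<open>The empty list counts as a path, which gives the choice of a longest path a starting
  point.\<close>

definition is_path :: "'a ugraph \<Rightarrow> 'a list \<Rightarrow> bool" where
  "is_path G p \<longleftrightarrow> distinct p \<and> set p \<subseteq> vertices G \<and> successively (\<lambda>u v. {u, v} \<in> edges G) p"

lemma neighbours_commute: "u \<in> neighbours G v \<longleftrightarrow> v \<in> neighbours G u"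
  by (simp add: neighbours_def insert_commute)

lemma neighbours_subset:
  assumes "simple_graph G"
  shows "neighbours G v \<subseteq> vertices G - {v}"
proof
  fix u assume "u \<in> neighbours G v"
  then have "{v, u} \<subseteq> vertices G \<and> card {v, u} = 2"
    using assms by (auto simp: neighbours_def simple_graph_def nsets_def)
  then show "u \<in> vertices G - {v}"
    by (cases "u = v") auto
qed

lemma finite_neighbours: "simple_graph G \<Longrightarrow> finite (neighbours G v)"
  by (meson finite_Diff finite_subset neighbours_subset simple_graph_def)

lemma is_path_Cons:
  "is_path G (v # p) \<longleftrightarrow>
    v \<in> vertices G \<and> v \<notin> set p \<and> (p = [] \<or> hd p \<in> neighbours G v) \<and> is_path G p"
  by (cases "p = []") (simp_all add: is_path_def neighbours_def successively_Cons conj_ac)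

lemma is_path_rev: "is_path G (rev p) \<longleftrightarrow> is_path G p"
  by (simp add: is_path_def insert_commute)

text \<open>The second hypothesis is the edge that closes the list into a cycle, so the cycle may be
  cut open just before \<open>v\<close> instead.\<close>

lemma is_path_rotate:
  assumes "is_path G (xs @ v # ys)" and "hd (xs @ v # ys) \<in> neighbours G (last (xs @ v # ys))"
  shows "is_path G (v # ys @ xs)"
proof (cases "xs = []")
  case False
  with assms show ?thesis
    unfolding is_path_def successively_append_iff[of _ xs "v # ys"]
      successively_append_iff[of _ "v # ys" xs, unfolded append_Cons]
    by (auto simp: neighbours_def)
qed (use assms in simp)

section \<open>Longest paths and Dirac's argument\<close>

lemma longest_path_neighbours_hd:
  assumes G: "simple_graph G" and p: "is_path G p" "p \<noteq> []"
    and longest: "\<And>q. is_path G q \<Longrightarrow> length q \<le> length p"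
  shows "neighbours G (hd p) \<subseteq> set p"
proof
  fix u assume u: "u \<in> neighbours G (hd p)"
  show "u \<in> set p"
  proof (rule ccontr)
    assume "u \<notin> set p"
    then have "is_path G (u # p)"
      using u p(1) neighbours_subset[OF G, of "hd p"]
      by (auto simp: is_path_Cons neighbours_commute)
    from longest[OF this] show False by simp
  qed
qed

text \<open>Crossing edges: if some \<open>p ! i\<close> is adjacent to the end of \<open>p\<close>
  while its successor is adjacent to the start, these two edges replace the edge between them and
  close a cycle. The degree sum forces such an index.\<close>

lemma longest_path_to_cycle:
  assumes G: "simple_graph G" and p: "is_path G p" "p \<noteq> []"
    and longest: "\<And>q. is_path G q \<Longrightarrow> length q \<le> length p"
    and deg: "card (neighbours G (hd p)) + card (neighbours G (last p)) \<ge> length p"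
  obtains c where "is_path G c" "set c = set p" "hd c \<in> neighbours G (last c)"
proof -
  define k where "k = length p - 1"
  have len: "length p = Suc k" using p(2) by (simp add: k_def)
  have hd: "hd p = p ! 0" and last: "last p = p ! k"
    using p(2) by (simp_all add: hd_conv_nth last_conv_nth k_def)
  define A where "A = {i. i < k \<and> p ! Suc i \<in> neighbours G (hd p)}"
  define B where "B = {i. i < k \<and> p ! i \<in> neighbours G (last p)}"
  have fin: "finite A" "finite B" by (simp_all add: A_def B_def)
  have "neighbours G (hd p) \<subseteq> (\<lambda>i. p ! Suc i) ` A"
  proof
    fix u assume u: "u \<in> neighbours G (hd p)"
    then have "u \<in> set p" using longest_path_neighbours_hd[OF G p longest] by blast
    then obtain j where j: "j \<le> k" "u = p ! j"
      by (metis in_set_conv_nth len less_Suc_eq_le)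
    \<comment> \<open>There are no loops, so a neighbour of \<open>hd p\<close> is not
      \<open>hd p\<close> itself and has a predecessor on \<open>p\<close>, at index
      \<open>j - 1\<close>.\<close>
    have "j \<noteq> 0"
      using u j(2) neighbours_subset[OF G, of "hd p"] hd by (metis DiffE insertI1 subsetD)
    then show "u \<in> (\<lambda>i. p ! Suc i) ` A"
      using u j by (intro image_eqI[of _ _ "j - 1"]) (auto simp: A_def)
  qed
  then have A: "card (neighbours G (hd p)) \<le> card A"
    using fin(1) by (meson card_image_le card_mono finite_imageI le_trans)
  \<comment> \<open>The reversed path is also longest, so the neighbours of its head lie on it as
    well.\<close>
  have "neighbours G (last p) \<subseteq> (\<lambda>i. p ! i) ` B"
  proof
    fix u assume u: "u \<in> neighbours G (last p)"
    then have "u \<in> set p"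
      using longest_path_neighbours_hd[OF G, of "rev p"] p longest
      by (auto simp: is_path_rev hd_rev)
    then obtain j where j: "j \<le> k" "u = p ! j"
      by (metis in_set_conv_nth len less_Suc_eq_le)
    have "j \<noteq> k"
      using u j(2) neighbours_subset[OF G, of "last p"] last by (metis DiffE insertI1 subsetD)
    then show "u \<in> (\<lambda>i. p ! i) ` B"
      using u j by (auto simp: B_def)
  qed
  then have B: "card (neighbours G (last p)) \<le> card B"
    using fin(2) by (meson card_image_le card_mono finite_imageI le_trans)
  \<comment> \<open>Pigeonhole: \<open>A\<close> and \<open>B\<close> lie among \<open>k\<close>
    indices, but their sizes add up to at least \<open>length p = Suc k\<close>.\<close>
  have "card (A \<union> B) \<le> card {..<k}"
    by (rule card_mono) (auto simp: A_def B_def)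
  then have "card (A \<inter> B) > 0"
    using A B deg len card_Un_Int[OF fin] by simp
  then obtain i where i: "i < k" "p ! Suc i \<in> neighbours G (hd p)" "p ! i \<in> neighbours G (last p)"
    by (auto simp: card_gt_0_iff A_def B_def)
  \<comment> \<open>The cycle follows \<open>p\<close> up to index \<open>i\<close>, jumps to
    \<open>last p\<close>, runs back to index \<open>Suc i\<close>, and returns from there to
    \<open>hd p\<close>.\<close>
  define xs ys where "xs = take (Suc i) p" and "ys = drop (Suc i) p"
  have ne: "xs \<noteq> []" "ys \<noteq> []" and pe: "p = xs @ ys"
    using i(1) len by (auto simp: xs_def ys_def)
  have ends: "last xs = p ! i" "hd ys = p ! Suc i" "hd xs = hd p" "last ys = last p"
    using i(1) len p(2)
    by (simp_all add: xs_def ys_def hd_drop_conv_nth last_conv_nth)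
  show thesis
  proof
    have "is_path G (xs @ ys)" using p(1) pe by simp
    then show "is_path G (xs @ rev ys)"
      using i(3) ne ends
      by (auto simp: is_path_def successively_append_iff hd_rev neighbours_def insert_commute)
    show "set (xs @ rev ys) = set p" by (simp add: pe)
    show "hd (xs @ rev ys) \<in> neighbours G (last (xs @ rev ys))"
      using i(2) ne ends by (simp add: last_rev neighbours_commute)
  qed
qed

text \<open>The threshold (|V| - 1) / 2 is half a unit below the one for Hamiltonian cycles. It
  suffices here because only a path that misses a vertex has to be closed into a cycle.\<close>

theorem dirac_hamiltonian_path:
  assumes G: "simple_graph G"
    and deg: "\<And>v. v \<in> vertices G \<Longrightarrow> card (vertices G) \<le> 2 * card (neighbours G v) + 1"
  obtains p where "is_path G p" "set p = vertices G"
proof -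
  let ?V = "vertices G"
  have fin: "finite ?V" using G by (simp add: simple_graph_def)
  have bound: "length q \<le> card ?V" if "is_path G q" for q
    using that fin by (metis card_mono distinct_card is_path_def)
  have "is_path G []" by (simp add: is_path_def)
  moreover have "\<forall>q. is_path G q \<longrightarrow> length q < Suc (card ?V)"
    using bound by (simp add: less_Suc_eq_le)
  ultimately obtain p where p: "is_path G p"
    and longest: "\<And>q. is_path G q \<Longrightarrow> length q \<le> length p"
    using Lattices_Big.ex_has_greatest_nat[of "is_path G" "[]" length] by blast
  have "set p = ?V"
  proof (rule ccontr)
    assume "set p \<noteq> ?V"
    then obtain w where w: "w \<in> ?V" "w \<notin> set p" using p by (auto simp: is_path_def)
    have ne: "p \<noteq> []" using longest[of "[w]"] w by (auto simp: is_path_def)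
    have lt: "length p < card ?V"
      using p w fin by (metis distinct_card is_path_def psubset_card_mono psubsetI)
    have "hd p \<in> ?V" "last p \<in> ?V" using p ne by (auto simp: is_path_def)
    \<comment> \<open>Since \<open>p\<close> misses \<open>w\<close>, its length is at most |V| - 1,
      and two degrees of at least (|V| - 1) / 2 add up to that.\<close>
    from deg[OF this(1)] deg[OF this(2)]
    have "length p \<le> card (neighbours G (hd p)) + card (neighbours G (last p))"
      using lt by linarith
    from longest_path_to_cycle[OF G p ne longest this] obtain c where
      c: "is_path G c" "set c = set p" "hd c \<in> neighbours G (last c)" by blast
    have cycle_closed: "x \<in> set c" if vx: "v \<in> set c" "x \<in> neighbours G v" for v x
    proof (rule ccontr)
      assume x: "x \<notin> set c"
      \<comment> \<open>Opening the cycle at \<open>v\<close> and putting \<open>x\<close> in front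
        gives a path with one vertex more than \<open>p\<close>.\<close>
      obtain xs ys where xy: "c = xs @ v # ys" using split_list[OF vx(1)] by blast
      have "is_path G (v # ys @ xs)" using is_path_rotate c xy by metis
      then have "is_path G (x # v # ys @ xs)"
        using vx x neighbours_subset[OF G, of v] xy
        by (subst is_path_Cons) (auto simp: neighbours_commute)
      moreover have "length p = length c"
        using p c by (metis distinct_card is_path_def)
      ultimately show False using longest xy by fastforce
    qed
    let ?v = "hd p"
    have v: "?v \<in> set c" "?v \<in> ?V" using ne c(2) p by (auto simp: is_path_def)
    have wv: "w \<noteq> ?v" "w \<notin> neighbours G ?v" using w c cycle_closed v by auto
    \<comment> \<open>Connectedness: \<open>w\<close> and \<open>?v\<close> are not adjacent, so
      both neighbourhoods lie in a set of |V| - 2 vertices. Their sizes add up to at least |V| - 1,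
      so they share a vertex, and \<open>cycle_closed\<close> carries membership in \<open>c\<close>
      from \<open>?v\<close> through it to \<open>w\<close>.\<close>
    have "neighbours G w \<union> neighbours G ?v \<subseteq> ?V - {w, ?v}"
      using neighbours_subset[OF G, of w] neighbours_subset[OF G, of ?v] wv
        neighbours_commute[of w G ?v] by auto
    then have "card (neighbours G w \<union> neighbours G ?v) \<le> card (?V - {w, ?v})"
      using fin by (intro card_mono) auto
    also have "\<dots> = card ?V - 2"
      using w v wv fin by (subst card_Diff_subset) auto
    finally have "card (neighbours G w \<union> neighbours G ?v) \<le> card ?V - 2" .
    \<comment> \<open>Ensures that the subtraction in the previous bound does not truncate.\<close>
    moreover have "card ?V \<ge> 2"
      using card_mono[OF fin, of "{w, ?v}"] w v wv by simp
    ultimately have "card (neighbours G w \<inter> neighbours G ?v) > 0"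
      using deg[OF w(1)] deg[OF v(2)]
        card_Un_Int[OF finite_neighbours[OF G, of w] finite_neighbours[OF G, of ?v]] by linarith
    then obtain x where "x \<in> neighbours G w" "x \<in> neighbours G ?v"
      by (auto simp: card_gt_0_iff)
    then have "w \<in> set c"
      using cycle_closed v by (metis neighbours_commute)
    with w c show False by simp
  qed
  with p that show thesis by blast
qed

section \<open>From vertex lists and degrees to copies of paths and stars\<close>

lemma contains_copy_path_graph:
  assumes "is_path G p" and "length p = n"
  shows "contains_copy G (path_graph n)"
  unfolding contains_copy_def
proof (intro exI[of _ "\<lambda>i. p ! i"] conjI)
  show "inj_on ((!) p) (vertices (path_graph n))"
    using assms by (auto simp: is_path_def path_graph_def inj_on_nth)
  show "(!) p ` vertices (path_graph n) \<subseteq> vertices G"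
    using assms by (auto simp: is_path_def path_graph_def)
  show "\<forall>e\<in>edges (path_graph n). (!) p ` e \<in> edges G"
    using assms by (auto simp: is_path_def path_graph_def successively_conv_nth)
qed

lemma contains_copy_star_graph:
  assumes G: "simple_graph G" and v: "v \<in> vertices G" and m: "m \<le> card (neighbours G v)"
  shows "contains_copy G (star_graph m)"
proof -
  obtain T where T: "T \<subseteq> neighbours G v" "card T = m" "finite T"
    using m by (metis obtain_subset_with_card_n)
  then obtain g where g: "bij_betw g {1..m} T"
    using finite_same_card_bij[of "{1..m}" T] by auto
  define f where "f i = (if i = 0 then v else g i)" for i
  have gT: "g i \<in> T" if "i \<in> {1..m}" for i using bij_betwE[OF g] that by blast
  have T_sub: "T \<subseteq> vertices G - {v}" using T(1) neighbours_subset[OF G, of v] by blast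
  show ?thesis
    unfolding contains_copy_def
  proof (intro exI[of _ f] conjI)
    have "inj_on f {1..m}"
      using bij_betw_imp_inj_on[OF g] by (subst inj_on_cong[of _ f g]) (simp_all add: f_def)
    moreover have "v \<notin> f ` {1..m}"
    proof
      assume "v \<in> f ` {1..m}"
      then obtain i where "i \<in> {1..m}" "v = g i" by (auto simp: f_def)
      with gT[of i] T_sub show False by blast
    qed
    moreover have "vertices (star_graph m) = insert 0 {1..m}"
      by (auto simp: star_graph_def)
    ultimately show "inj_on f (vertices (star_graph m))"
      by (simp add: f_def)
    show "f ` vertices (star_graph m) \<subseteq> vertices G"
      using v gT T_sub by (auto simp: star_graph_def f_def subset_iff)
    show "\<forall>e\<in>edges (star_graph m). f ` e \<in> edges G"
    proof
      fix e assume "e \<in> edges (star_graph m)"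
      then obtain i where i: "i \<in> {1..m}" "e = {0, i}" by (auto simp: star_graph_def)
      then have "f ` e = {v, g i}" by (auto simp: f_def)
      moreover have "g i \<in> neighbours G v" using gT[OF i(1)] T(1) by blast
      ultimately show "f ` e \<in> edges G" by (simp add: neighbours_def)
    qed
  qed
qed

text \<open>Without a red star every red degree is at most m - 1, so twice a blue degree is at least
  (|V| + 2m - 3) - 2(m - 1) = |V| - 1, which is the hypothesis of
  \<open>dirac_hamiltonian_path\<close>.\<close>

lemma arrows_star_path_if_degree:
  assumes F: "simple_graph F"
    and deg: "\<And>v. v \<in> vertices F \<Longrightarrow>
      card (vertices F) + 2 * m \<le> 2 * card (neighbours F v) + 3"
  shows "arrows F (star_graph m) (path_graph (card (vertices F)))"
  unfolding arrows_def
proof (intro allI impI)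
  fix R B assume RB: "R \<union> B = edges F \<and> R \<inter> B = {}"
  let ?R = "(vertices F, R)" and ?B = "(vertices F, B)"
  have simple: "simple_graph ?R" "simple_graph ?B" using F RB by (auto simp: simple_graph_def)
  show "contains_copy ?R (star_graph m) \<or> contains_copy ?B (path_graph (card (vertices F)))"
  proof (rule disjCI)
    assume no_path: "\<not> contains_copy ?B (path_graph (card (vertices F)))"
    show "contains_copy ?R (star_graph m)"
    proof (rule ccontr)
      assume no_star: "\<not> contains_copy ?R (star_graph m)"
      have "card (vertices ?B) \<le> 2 * card (neighbours ?B v) + 1" if "v \<in> vertices ?B" for v
      proof -
        have "card (neighbours ?R v) < m"
          using contains_copy_star_graph[OF simple(1), of v m] no_star that by force
        moreover have "neighbours F v = neighbours ?R v \<union> neighbours ?B v"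
          using RB by (auto simp: neighbours_def)
        then have "card (neighbours F v) \<le> card (neighbours ?R v) + card (neighbours ?B v)"
          by (simp add: card_Un_le)
        ultimately show ?thesis using deg[of v] that by simp
      qed
      from dirac_hamiltonian_path[OF simple(2) this] obtain p
        where "is_path ?B p" "set p = vertices F" by auto
      moreover from this have "length p = card (vertices F)"
        by (metis distinct_card is_path_def)
      ultimately show False using contains_copy_path_graph no_path by blast
    qed
  qed
qed

section \<open>Arrowing by complete graphs with or without a deleted path\<close>

lemma card_neighbours_complete_minus_path:
  assumes "v < r"
  shows "r \<le> card (neighbours (complete_minus_path r k) v) + 3"
proof -
  \<comment> \<open>Besides \<open>v\<close> itself, only its two possible neighbours on the deleted
    path can be lost. For \<open>v = 0\<close> the term \<open>v - 1\<close> is \<open>v\<close>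
    again, which does no harm.\<close>
  have "{..<r} - {v, Suc v, v - 1} \<subseteq> neighbours (complete_minus_path r k) v"
    using assms
    by (auto simp: neighbours_def complete_minus_path_def complete_graph_def path_graph_def
        nsets_def doubleton_eq_iff)
  then have "card ({..<r} - {v, Suc v, v - 1}) \<le> card (neighbours (complete_minus_path r k) v)"
    by (intro card_mono finite_neighbours simple_graph_complete_minus_path)
  moreover have "r - card {v, Suc v, v - 1} \<le> card ({..<r} - {v, Suc v, v - 1})"
    using diff_card_le_card_Diff[of "{v, Suc v, v - 1}" "{..<r}"] by simp
  moreover have "card {v, Suc v, v - 1} \<le> 3"
    by (simp add: card_insert_if)
  ultimately show ?thesis by linarith
qed

text \<open>With all degrees at least n - 3, the degree condition follows from n + 2m \<le> 2(n - 3)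
  + 3, that is, from n \<ge> 2m + 3. Leaving \<open>k\<close> free covers the complete graph
  (\<open>k = 0\<close>) together with every deleted path.\<close>

lemma arrows_complete_minus_path:
  assumes "n \<ge> 2 * m + 3"
  shows "arrows (complete_minus_path n k) (star_graph m) (path_graph n)"
proof -
  have card: "vertices (complete_minus_path n k) = {..<n}"
    by (simp add: complete_minus_path_def complete_graph_def)
  have "n + 2 * m \<le> 2 * card (neighbours (complete_minus_path n k) v) + 3" if "v < n" for v
    using card_neighbours_complete_minus_path[OF that, of k] assms by linarith
  then show ?thesis
    using arrows_star_path_if_degree[OF simple_graph_complete_minus_path, of n k m]
    by (simp add: card)
qed

text \<open>Color every edge blue: a star with at least one edge finds no red edge, and
  \<open>n\<close> path vertices do not fit injectively into \<open>r\<close>.\<close>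

lemma not_arrows_complete_graph:
  assumes "m \<ge> 1" and "r < n"
  shows "\<not> arrows (complete_graph r) (star_graph m) (path_graph n)"
proof
  let ?K = "complete_graph r"
  assume "arrows ?K (star_graph m) (path_graph n)"
  then have "{} \<union> edges ?K = edges ?K \<and> {} \<inter> edges ?K = {} \<longrightarrow>
      contains_copy (vertices ?K, {}) (star_graph m) \<or>
      contains_copy (vertices ?K, edges ?K) (path_graph n)"
    unfolding arrows_def by (elim allE)
  moreover have "\<not> contains_copy (vertices ?K, {}) (star_graph m)"
    using assms(1) by (auto simp: contains_copy_def star_graph_def)
  moreover have "\<not> contains_copy (vertices ?K, edges ?K) (path_graph n)"
  proof
    assume "contains_copy (vertices ?K, edges ?K) (path_graph n)"
    then obtain f where "inj_on f {..<n}" "f ` {..<n} \<subseteq> {..<r}"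
      by (auto simp: contains_copy_def path_graph_def complete_graph_def)
    then have "n \<le> r" using card_inj_on_le[of f "{..<n}" "{..<r}"] by simp
    with assms(2) show False by simp
  qed
  ultimately show False by simp
qed

section \<open>The Ramsey number and the path-critical Ramsey number\<close>

lemma complete_minus_path_0: "complete_minus_path r 0 = complete_graph r"
  by (simp add: complete_minus_path_def path_graph_def)

lemma ramsey_number_star_path:
  assumes "m \<ge> 1" and "n \<ge> 2 * m + 3"
  shows "ramsey_number (star_graph m) (path_graph n) = n"
  unfolding ramsey_number_def
proof (rule Least_equality)
  show "arrows (complete_graph n) (star_graph m) (path_graph n)"
    using arrows_complete_minus_path[OF assms(2), of 0] by (simp add: complete_minus_path_0)
  show "n \<le> r" if "arrows (complete_graph r) (star_graph m) (path_graph n)" for r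
    using that not_arrows_complete_graph[OF assms(1)] by (meson not_le)
qed

theorem theorem4:
  fixes m n :: nat
  assumes "m \<ge> 1" and "n \<ge> 2 * m + 3"
  shows "path_critical_ramsey (star_graph m) (path_graph n) = n"
proof -
  \<comment> \<open>Arrowing holds for every \<open>k\<close>, so the maximum is set by the cap on
    \<open>k\<close>, the Ramsey number \<open>n\<close>: even a Hamiltonian path may be
    deleted.\<close>
  have "{k. 1 \<le> k \<and> k \<le> n \<and> arrows (complete_minus_path n k) (star_graph m) (path_graph n)} = {1..n}"
    using arrows_complete_minus_path[OF assms(2)] by auto
  then have "path_critical_ramsey (star_graph m) (path_graph n) = Max {1..n}"
    by (simp only: path_critical_ramsey_def ramsey_number_star_path[OF assms] Let_def)
  also have "\<dots> = n"
    using assms by (intro Max_eqI) auto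
  finally show ?thesis .
qed

end
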